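(* Let $\mathcal{A}$ and $\mathcal{B}$ be normed spectral state spaces and let $F:\mathcal{A}\to\mathcal{B}$ be a spectrally analytic operadic propagation map associated with an admissible network (for example its global evaluation map, or any composition of edge couplings). Suppose that $F$ admits a spectral Taylor expansion around $A\in\mathcal{A}$ up to order $n$, with spectral radius of convergence $R_F>0$. Then for every perturbation $\delta A$ with $\|\sigma_P(\delta A)\|<R_F$, $$\|F(A+\delta A)-F(A)\|\le\sum_{k=1}^{n}\frac{1}{k!}\,\bigl\|\partial_k^{\mathrm{spec}}F(A)\bigr\|\,\|\delta A\|^k+\|R_{n+1}(A,\delta A)\|,$$ where the remainder satisfies $$\|R_{n+1}(A,\delta A)\|\le C_{n+1}\,\|\delta A\|^{n+1},\qquad C_{n+1}:=\sup_{\|\sigma_P(t\delta A)\|<R_F,\ t\in[0,1]}\frac{1}{(n+1)!}\bigl\|\partial_{n+1}^{\mathrm{spec}}F(A+t\,\delta A)\bigr\|.$$ In particular, if $\|\partial_{n+1}^{\mathrm{spec}}F\|$ is bounded by a constant $M_{n+1}$ uniformly on the ball of radius $\|\delta A\|$ (around $A$), then $C_{n+1}\le M_{n+1}/(n+1)!$.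
   Context: **Spectral state space.** A normed vector space on which, in addition, a nonnegative spectral size $\|\sigma_P(\cdot)\|$ is defined (the size of the operadic spectrum of an element, a notion imported from the author's earlier work). **Spectral derivatives and spectral analyticity.** For $k\ge1$, the $k$-th spectral derivative of $F$ at $A$ is a bounded $k$-multilinear operator $\partial_k^{\mathrm{spec}}F(A):\mathcal{A}^{\otimes k}\to\mathcal{B}$, and $\|\partial_k^{\mathrm{spec}}F(A)\|$ is its multilinear operator norm, so that $\|\partial_k^{\mathrm{spec}}F(A)[\delta A^{\otimes k}]\|\le\|\partial_k^{\mathrm{spec}}F(A)\|\,\|\delta A\|^k$. $F$ is spectrally analytic with spectral radius of convergence $R_F>0$ if for all $\delta A$ with $\|\sigma_P(\delta A)\|<R_F$ its spectral Taylor expansion $F(A+\delta A)=F(A)+\sum_{k\ge1}\frac1{k!}\partial_k^{\mathrm{spec}}F(A)[\delta A^{\otimes k}]$ converges. The spectral derivatives are the Fréchet-type derivatives of $F$. **Remainder.** $R_{n+1}(A,\delta A):=F(A+\delta A)-F(A)-\sum_{k=1}^n\frac1{k!}\partial_k^{\mathrm{spec}}F(A)[\delta A^{\otimes k}]$. **Network background.** An admissible network is a finite directed graph whose nodes carry spectrally analytic algebras $A_v$ over a colored operad $P$ and whose edges carry coupling maps $\tau_e:A_{s(e)}\to A_{t(e)}$, such that the compositions of couplings around cycles are contractive with a uniform constant less than $1$. Its global evaluation map sends the node data to the assembled spectral object. Only the analytic properties of $F$ listed above enter the statement.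
   Formalization: Adds the assumption that the spectral size satisfies ‖σ_P(tx)‖ ≤ ‖σ_P(x)‖ for 0 ≤ t ≤ 1, so the segment from A to A+δA stays in the spectral domain; with mere nonnegativity the remainder bound can fail. *)

theory Defs
  imports "HOL-Analysis.Analysis"
begin

class spectral_state_space = real_normed_vector +
  fixes spectral_size :: "'a \<Rightarrow> real"
  assumes spectral_size_nonneg: "0 \<le> spectral_size x"

text \<open>
  A \<open>k\<close>-multilinear operator is represented by a function on lists; only its values on
  lists of length \<open>k\<close> are meaningful.
\<close>

definition bounded_multilinear ::
    "nat \<Rightarrow> ('a::real_normed_vector list \<Rightarrow> 'b::real_normed_vector) \<Rightarrow> bool" where
  "bounded_multilinear k T \<longleftrightarrow>
     (\<forall>xs i. length xs = k \<and> i < k \<longrightarrow> linear (\<lambda>u. T (xs[i := u]))) \<and>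
     (\<exists>K. \<forall>xs. length xs = k \<longrightarrow> norm (T xs) \<le> K * (\<Prod>x\<leftarrow>xs. norm x))"

text \<open>The analogue of \<^const>\<open>onorm\<close>, with the same convention that \<open>y / 0 = 0\<close>.\<close>

definition multilinear_norm ::
    "nat \<Rightarrow> ('a::real_normed_vector list \<Rightarrow> 'b::real_normed_vector) \<Rightarrow> real" where
  "multilinear_norm k T = (SUP xs\<in>{xs. length xs = k}. norm (T xs) / (\<Prod>x\<leftarrow>xs. norm x))"

text \<open>
  Frechet differentiability, in the operator norm, of a map \<open>G\<close> with values in the
  \<open>k\<close>-multilinear operators; the derivative is uncurried to a \<open>(k+1)\<close>-multilinear operator
  \<open>T\<close> whose first argument is the direction of differentiation.
\<close>

definition has_multilinear_derivative ::
    "nat \<Rightarrow> ('a::real_normed_vector \<Rightarrow> 'a list \<Rightarrow> 'b::real_normed_vector)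
      \<Rightarrow> ('a list \<Rightarrow> 'b) \<Rightarrow> 'a \<Rightarrow> bool" where
  "has_multilinear_derivative k G T x \<longleftrightarrow>
     bounded_multilinear (Suc k) T \<and>
     ((\<lambda>y. multilinear_norm k (\<lambda>xs. G y xs - G x xs - T ((y - x) # xs)) / norm (y - x))
        \<longlongrightarrow> 0) (at x)"

text \<open>
  The iterated derivative is meaningful at \<open>x\<close> only under the differentiability predicate
  below, which makes it unique on lists of length \<open>k\<close>.
\<close>

primrec spectral_derivative ::
    "('a::real_normed_vector \<Rightarrow> 'b::real_normed_vector) \<Rightarrow> nat \<Rightarrow> 'a \<Rightarrow> 'a list \<Rightarrow> 'b" where
  "spectral_derivative F 0 = (\<lambda>x xs. F x)"
| "spectral_derivative F (Suc k) =
     (\<lambda>x. SOME T. has_multilinear_derivative k (spectral_derivative F k) T x)"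

primrec spectrally_differentiable ::
    "('a::real_normed_vector \<Rightarrow> 'b::real_normed_vector) \<Rightarrow> nat \<Rightarrow> 'a \<Rightarrow> bool" where
  "spectrally_differentiable F 0 = (\<lambda>x. True)"
| "spectrally_differentiable F (Suc k) =
     (\<lambda>x. (\<forall>\<^sub>F y in nhds x. spectrally_differentiable F k y) \<and>
          (\<exists>T. has_multilinear_derivative k (spectral_derivative F k) T x))"

abbreviation spectral_derivative_norm ::
    "('a::real_normed_vector \<Rightarrow> 'b::real_normed_vector) \<Rightarrow> nat \<Rightarrow> 'a \<Rightarrow> real" where
  "spectral_derivative_norm F k x \<equiv> multilinear_norm k (spectral_derivative F k x)"

definition spectrally_analytic_at ::
    "('a::spectral_state_space \<Rightarrow> 'b::real_normed_vector) \<Rightarrow> 'a \<Rightarrow> real \<Rightarrow> bool" where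
  "spectrally_analytic_at F A R \<longleftrightarrow>
     0 < R \<and>
     (\<forall>h. spectral_size h < R \<longrightarrow>
        (\<forall>k. spectrally_differentiable F k (A + h)) \<and>
        (\<lambda>k. (1 / fact (Suc k)) *\<^sub>R spectral_derivative F (Suc k) A (replicate (Suc k) h))
          sums (F (A + h) - F A))"

text \<open>
  Indexed by the order \<open>n\<close> of the expansion; this is the remainder customarily written with
  index \<open>n + 1\<close>.
\<close>

definition spectral_remainder ::
    "('a::real_normed_vector \<Rightarrow> 'b::real_normed_vector) \<Rightarrow> nat \<Rightarrow> 'a \<Rightarrow> 'a \<Rightarrow> 'b" where
  "spectral_remainder F n A h =
     F (A + h) - F A
       - (\<Sum>k=1..n. (1 / fact k) *\<^sub>R spectral_derivative F k A (replicate k h))"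

text \<open>Extended-real valued, since no finiteness of the supremum is presupposed.\<close>

definition remainder_constant ::
    "('a::spectral_state_space \<Rightarrow> 'b::real_normed_vector) \<Rightarrow> real \<Rightarrow> nat \<Rightarrow> 'a \<Rightarrow> 'a \<Rightarrow> ereal" where
  "remainder_constant F R m A h =
     (SUP t\<in>{t\<in>{0..1}. spectral_size (t *\<^sub>R h) < R}.
        ereal (1 / fact m * spectral_derivative_norm F m (A + t *\<^sub>R h)))"

end

theory Submission
  imports Defs
begin

text \<open>
  Along the segment \<open>t \<mapsto> A + t *\<^sub>R \<delta>\<close> the function \<open>\<partial>\<^sub>k F(A + t *\<^sub>R \<delta>)[\<delta>, \<dots>, \<delta>]\<close> has derivative
  \<open>\<partial>\<^sub>k\<^sub>+\<^sub>1 F(A + t *\<^sub>R \<delta>)[\<delta>, \<dots>, \<delta>]\<close>, and the remainder is estimated by iterating the mean value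
  inequality. Neither space is assumed complete, so the integral form of the remainder is not
  available.
\<close>

section \<open>Operator norms of bounded multilinear maps\<close>

lemma bounded_multilinear_bound_nonneg:
  assumes "bounded_multilinear k T"
  shows "\<exists>K\<ge>0. \<forall>xs. length xs = k \<longrightarrow> norm (T xs) \<le> K * (\<Prod>x\<leftarrow>xs. norm x)"
proof -
  obtain K where K: "\<And>xs. length xs = k \<Longrightarrow> norm (T xs) \<le> K * (\<Prod>x\<leftarrow>xs. norm x)"
    using assms unfolding bounded_multilinear_def by blast
  have "norm (T xs) \<le> \<bar>K\<bar> * (\<Prod>x\<leftarrow>xs. norm x)" if "length xs = k" for xs
  proof -
    have "0 \<le> (\<Prod>x\<leftarrow>xs. norm x)"
      by (rule prod_list_nonneg) auto
    then have "K * (\<Prod>x\<leftarrow>xs. norm x) \<le> \<bar>K\<bar> * (\<Prod>x\<leftarrow>xs. norm x)"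
      by (intro mult_right_mono) auto
    then show ?thesis
      using K[OF that] by linarith
  qed
  then show ?thesis
    by (intro exI[of _ "\<bar>K\<bar>"]) simp
qed

text \<open>The bound \<open>K\<close> makes the set of quotients bounded above, so the real-valued
  \<open>SUP\<close> dominates each of them; \<open>0 \<le> K\<close> covers zero denominators. An
  explicit bound is assumed instead of \<open>bounded_multilinear\<close> so that the difference
  maps in \<open>has_multilinear_derivative\<close> are covered as well.\<close>

lemma quotient_le_multilinear_norm:
  fixes T :: "'a::real_normed_vector list \<Rightarrow> 'b::real_normed_vector"
  assumes K: "0 \<le> K" "\<forall>xs. length xs = k \<longrightarrow> norm (T xs) \<le> K * (\<Prod>x\<leftarrow>xs. norm x)"
    and xs: "length xs = k"
  shows "norm (T xs) / (\<Prod>x\<leftarrow>xs. norm x) \<le> multilinear_norm k T"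
proof -
  have "norm (T ys) / (\<Prod>x\<leftarrow>ys. norm x) \<le> K" if "length ys = k" for ys
  proof -
    have "0 \<le> (\<Prod>x\<leftarrow>ys. norm x)"
      by (rule prod_list_nonneg) auto
    then show ?thesis
      using K(1) K(2)[rule_format, OF that]
      by (cases "(\<Prod>x\<leftarrow>ys. norm x) = 0") (simp_all add: divide_le_eq)
  qed
  then show ?thesis
    unfolding multilinear_norm_def using xs
    by (intro cSUP_upper bdd_aboveI2[where M = K]) auto
qed

lemma norm_le_multilinear_norm:
  fixes T :: "'a::real_normed_vector list \<Rightarrow> 'b::real_normed_vector"
  assumes K: "0 \<le> K" "\<forall>xs. length xs = k \<longrightarrow> norm (T xs) \<le> K * (\<Prod>x\<leftarrow>xs. norm x)"
    and xs: "length xs = k"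
  shows "norm (T xs) \<le> multilinear_norm k T * (\<Prod>x\<leftarrow>xs. norm x)"
proof (cases "(\<Prod>x\<leftarrow>xs. norm x) = 0")
  \<comment> \<open>Here the quotient is 0 by convention and carries no information;
    \<open>T xs = 0\<close> comes from the bound \<open>K\<close> instead.\<close>
  case True
  then show ?thesis
    using K(2)[rule_format, OF xs] by simp
next
  case False
  moreover have "0 \<le> (\<Prod>x\<leftarrow>xs. norm x)"
    by (rule prod_list_nonneg) auto
  ultimately show ?thesis
    using quotient_le_multilinear_norm[OF assms] by (simp add: divide_le_eq)
qed

lemma norm_replicate_le_multilinear_norm:
  assumes "bounded_multilinear k T"
  shows "norm (T (replicate k h)) \<le> multilinear_norm k T * norm h ^ k"
proof -
  obtain K where "0 \<le> K" "\<forall>xs. length xs = k \<longrightarrow> norm (T xs) \<le> K * (\<Prod>x\<leftarrow>xs. norm x)"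
    using bounded_multilinear_bound_nonneg[OF assms] by blast
  from norm_le_multilinear_norm[OF this, of "replicate k h"] show ?thesis
    by simp
qed

lemma multilinear_norm_nonneg:
  fixes T :: "'a::real_normed_vector list \<Rightarrow> 'b::real_normed_vector"
  assumes "bounded_multilinear k T"
  shows "0 \<le> multilinear_norm k T"
proof -
  obtain K where "0 \<le> K" "\<forall>xs. length xs = k \<longrightarrow> norm (T xs) \<le> K * (\<Prod>x\<leftarrow>xs. norm x)"
    using bounded_multilinear_bound_nonneg[OF assms] by blast
  \<comment> \<open>Any list of length \<open>k\<close> would do: its quotient is nonnegative and
    lies below the supremum.\<close>
  from quotient_le_multilinear_norm[OF this, of "replicate k 0"]
  have "norm (T (replicate k 0)) / norm (0 :: 'a) ^ k \<le> multilinear_norm k T"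
    by simp
  moreover have "0 \<le> norm (T (replicate k 0)) / norm (0 :: 'a) ^ k"
    by simp
  ultimately show ?thesis
    by linarith
qed

section \<open>Differentiation of spectral derivatives along the segment\<close>

text \<open>Evaluation at a fixed \<open>xs\<close> costs only the constant factor
  \<open>?p\<close>, so convergence in operator norm passes to the values. Boundedness near
  \<open>x\<close> is assumed because \<open>multilinear_norm\<close> is a true supremum only for
  bounded maps, and \<open>has_multilinear_derivative\<close> itself bounds only
  \<open>T\<close>.\<close>

lemma has_multilinear_derivative_imp_has_derivative:
  assumes deriv: "has_multilinear_derivative k G T x"
    and bounded: "\<forall>\<^sub>F y in nhds x. bounded_multilinear k (G y)"
    and xs: "length xs = k"
  shows "((\<lambda>y. G y xs) has_derivative (\<lambda>h. T (h # xs))) (at x)"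
proof -
  let ?p = "\<Prod>x\<leftarrow>xs. norm x"
  let ?D = "\<lambda>y ys. G y ys - G x ys - T ((y - x) # ys)"
  have T: "bounded_multilinear (Suc k) T"
    and lim: "((\<lambda>y. multilinear_norm k (?D y) / norm (y - x)) \<longlongrightarrow> 0) (at x)"
    using deriv unfolding has_multilinear_derivative_def by auto
  obtain KT where KT: "0 \<le> KT"
      "\<forall>ys. length ys = Suc k \<longrightarrow> norm (T ys) \<le> KT * (\<Prod>x\<leftarrow>ys. norm x)"
    using bounded_multilinear_bound_nonneg[OF T] by blast
  \<comment> \<open>Slot 0 is the direction of differentiation; the entry \<open>0\<close> is a
    placeholder that the update overwrites.\<close>
  have "linear (\<lambda>h. T ((0 # xs)[0 := h]))"
    using T xs unfolding bounded_multilinear_def by (metis length_Cons zero_less_Suc)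
  then have linear: "bounded_linear (\<lambda>h. T (h # xs))"
    using KT(2)[rule_format, of "h # xs" for h] xs
    by (intro bounded_linear.intro bounded_linear_axioms.intro exI[of _ "KT * ?p"])
      (auto simp: ac_simps)
  obtain Kx where Kx: "0 \<le> Kx"
      "\<forall>ys. length ys = k \<longrightarrow> norm (G x ys) \<le> Kx * (\<Prod>x\<leftarrow>ys. norm x)"
    using bounded_multilinear_bound_nonneg[OF eventually_nhds_x_imp_x[OF bounded]] by blast
  have "norm (?D y xs) \<le> multilinear_norm k (?D y) * ?p" if y: "bounded_multilinear k (G y)" for y
  proof -
    obtain Ky where Ky: "0 \<le> Ky"
        "\<forall>ys. length ys = k \<longrightarrow> norm (G y ys) \<le> Ky * (\<Prod>x\<leftarrow>ys. norm x)"
      using bounded_multilinear_bound_nonneg[OF y] by blast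
    \<comment> \<open>This bound need not be small: it only ensures that the supremum defining
      \<open>multilinear_norm k (?D y)\<close> is finite.\<close>
    have "norm (?D y ys) \<le> (Ky + Kx + KT * norm (y - x)) * (\<Prod>x\<leftarrow>ys. norm x)"
      if "length ys = k" for ys
    proof -
      have "norm (?D y ys) \<le> norm (G y ys) + norm (G x ys) + norm (T ((y - x) # ys))"
        by (meson add_right_mono norm_triangle_ineq4 order_trans)
      also have "\<dots> \<le> (Ky + Kx + KT * norm (y - x)) * (\<Prod>x\<leftarrow>ys. norm x)"
        using Kx(2)[rule_format, OF that] Ky(2)[rule_format, OF that] KT(2)[rule_format, of "(y - x) # ys"] that
        by (simp add: algebra_simps)
      finally show ?thesis .
    qed
    then show ?thesis
      using Kx(1) Ky(1) KT(1) xs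
      by (intro norm_le_multilinear_norm[where K = "Ky + Kx + KT * norm (y - x)"]) auto
  qed
  moreover have "\<forall>\<^sub>F y in at x. bounded_multilinear k (G y)"
    using bounded by (simp add: eventually_nhds_conv_at)
  ultimately have "\<forall>\<^sub>F y in at x. norm (norm (?D y xs) / norm (y - x))
      \<le> multilinear_norm k (?D y) / norm (y - x) * ?p"
    by (auto elim!: eventually_mono simp: divide_right_mono)
  moreover have "((\<lambda>y. multilinear_norm k (?D y) / norm (y - x) * ?p) \<longlongrightarrow> 0) (at x)"
    using tendsto_mult_right[OF lim, of ?p] by simp
  ultimately have "((\<lambda>y. norm (?D y xs) / norm (y - x)) \<longlongrightarrow> 0) (at x)"
    by (rule Lim_null_comparison)
  then show ?thesis
    unfolding has_derivative_iff_norm using linear by simp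
qed

text \<open>The existence clause of \<open>spectrally_differentiable\<close> supplies the witness
  behind the choice by \<open>SOME\<close>.\<close>

lemma spectral_derivative_Suc:
  assumes "spectrally_differentiable F (Suc k) x"
  shows "has_multilinear_derivative k (spectral_derivative F k) (spectral_derivative F (Suc k) x) x"
  using assms someI_ex[of "\<lambda>T. has_multilinear_derivative k (spectral_derivative F k) T x"]
  by simp

lemma bounded_multilinear_spectral_derivative:
  assumes "spectrally_differentiable F k x"
  shows "bounded_multilinear k (spectral_derivative F k x)"
proof (cases k)
  case 0
  then show ?thesis
    by (auto simp: bounded_multilinear_def)
next
  case (Suc l)
  then show ?thesis
    using spectral_derivative_Suc assms unfolding has_multilinear_derivative_def by blast
qed

text \<open>Chain rule along an affine path: the velocity \<open>h\<close> enters the first slot of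
  the next derivative and joins the \<open>k\<close> copies already there.\<close>

lemma has_vector_derivative_spectral_derivative_segment:
  assumes "spectrally_differentiable F (Suc k) (A + t *\<^sub>R h)"
  shows "((\<lambda>s. spectral_derivative F k (A + s *\<^sub>R h) (replicate k h)) has_vector_derivative
           spectral_derivative F (Suc k) (A + t *\<^sub>R h) (replicate (Suc k) h)) (at t)"
proof -
  let ?x = "A + t *\<^sub>R h"
  let ?T = "spectral_derivative F (Suc k) ?x"
  \<comment> \<open>Differentiability of order \<open>Suc k\<close> at a point includes order
    \<open>k\<close> on a whole neighbourhood, hence local boundedness.\<close>
  have "\<forall>\<^sub>F y in nhds ?x. bounded_multilinear k (spectral_derivative F k y)"
    using assms by (auto elim: eventually_mono intro: bounded_multilinear_spectral_derivative)
  then have D: "((\<lambda>y. spectral_derivative F k y (replicate k h)) has_derivative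
      (\<lambda>u. ?T (u # replicate k h))) (at ?x)"
    using spectral_derivative_Suc[OF assms]
    by (intro has_multilinear_derivative_imp_has_derivative) auto
  have "((\<lambda>s. A + s *\<^sub>R h) has_derivative (\<lambda>r. r *\<^sub>R h)) (at t)"
    by (auto intro!: derivative_eq_intros)
  from has_derivative_compose[OF this D]
  have "((\<lambda>s. spectral_derivative F k (A + s *\<^sub>R h) (replicate k h)) has_derivative
      (\<lambda>r. ?T (r *\<^sub>R h # replicate k h))) (at t)" .
  moreover have "?T (r *\<^sub>R h # replicate k h) = r *\<^sub>R ?T (h # replicate k h)" for r
    using linear_cmul[OF has_derivative_linear[OF D]] .
  ultimately show ?thesis
    unfolding has_vector_derivative_def by (simp del: spectral_derivative.simps)
qed

section \<open>Taylor bound for vector-valued functions of a real variable\<close>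

text \<open>Differentiating the remainder of order \<open>Suc n\<close> gives the remainder of order
  \<open>n\<close> for the shifted family \<open>\<lambda>k. g (Suc k)\<close>. The induction
  hypothesis bounds that derivative by \<open>\<phi>'\<close>, and the mean value inequality turns
  this into the bound \<open>\<phi>\<close>.\<close>

lemma vector_taylor_bound:
  fixes g :: "nat \<Rightarrow> real \<Rightarrow> 'b::real_normed_vector"
  assumes "\<And>k t. k < n \<Longrightarrow> t \<in> {0..1} \<Longrightarrow> (g k has_vector_derivative g (Suc k) t) (at t)"
    and "\<And>t. t \<in> {0..1} \<Longrightarrow> norm (g n t) \<le> K"
    and "s \<in> {0..1}"
  shows "norm (g 0 s - (\<Sum>k<n. (s ^ k / fact k) *\<^sub>R g k 0)) \<le> K * s ^ n / fact n"
  using assms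
proof (induction n arbitrary: g s)
  case 0
  then show ?case
    by simp
next
  case (Suc n)
  define f where "f s = g 0 s - (\<Sum>k<Suc n. (s ^ k / fact k) *\<^sub>R g k 0)" for s
  define f' where "f' s = g 1 s - (\<Sum>k<n. (s ^ k / fact k) *\<^sub>R g (Suc k) 0)" for s
  define \<phi> where "\<phi> s = K * s ^ Suc n / fact (Suc n)" for s
  define \<phi>' where "\<phi>' s = K * s ^ n / fact n" for s
  \<comment> \<open>Term \<open>Suc k\<close> of the Taylor sum differentiates to term
    \<open>k\<close> for the shifted family; the constant term drops out.\<close>
  have "((\<lambda>s. (s ^ Suc k / fact (Suc k)) *\<^sub>R g (Suc k) 0) has_vector_derivative
      (t ^ k / fact k) *\<^sub>R g (Suc k) 0) (at t)" for k t
  proof -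
    have "((\<lambda>s. s ^ Suc k / fact (Suc k)) has_real_derivative t ^ k / fact k) (at t)"
      by (rule derivative_eq_intros refl | simp add: divide_simps)+
    from has_vector_derivative_scaleR[OF this has_vector_derivative_const] show ?thesis
      by simp
  qed
  from has_vector_derivative_diff[OF
      has_vector_derivative_diff[OF Suc.prems(1)[of 0] has_vector_derivative_const[of "g 0 0"]]
      has_vector_derivative_sum[of "{..<n}", OF this]]
  have f: "(f has_vector_derivative f' t) (at t)" if "t \<in> {0..1}" for t
    using that unfolding f_def f'_def sum.lessThan_Suc_shift
    by (simp add: diff_diff_eq del: fact_Suc power_Suc)
  have \<phi>: "(\<phi> has_vector_derivative \<phi>' t) (at t)" for t
    unfolding \<phi>_def \<phi>'_def has_real_derivative_iff_has_vector_derivative[symmetric]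
    by (rule derivative_eq_intros refl | simp add: divide_simps)+
  have bound: "norm (f' t) \<le> \<phi>' t" if "t \<in> {0..1}" for t
    using Suc.IH[of "\<lambda>k. g (Suc k)" t] Suc.prems that unfolding f'_def \<phi>'_def by simp
  have "f 0 = 0" "\<phi> 0 = 0"
    by (simp_all add: f_def \<phi>_def sum.lessThan_Suc_shift del: sum.lessThan_Suc)
  show ?case
  \<comment> \<open>The mean value inequality below asks for a nondegenerate interval.\<close>
  proof (cases "s = 0")
    case True
    then show ?thesis
      using \<open>f 0 = 0\<close> by (simp add: f_def)
  next
    case False
    then have s: "0 < s" "s \<le> 1"
      using Suc.prems(3) by auto
    have "norm (f s - f 0) \<le> \<phi> s - \<phi> 0"
    proof (rule differentiable_bound_general[where f' = f' and \<phi>' = \<phi>', OF s(1)])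
      show "continuous_on {0..s} f"
        using s by (intro continuous_at_imp_continuous_on ballI
            has_vector_derivative_continuous[OF f]) auto
      show "continuous_on {0..s} \<phi>"
        by (intro continuous_at_imp_continuous_on ballI
            has_vector_derivative_continuous[OF \<phi>])
    qed (use f \<phi> bound s in auto)
    then show ?thesis
      using \<open>f 0 = 0\<close> \<open>\<phi> 0 = 0\<close> by (simp add: f_def \<phi>_def)
  qed
qed

section \<open>The perturbation bound and its remainder\<close>

text \<open>\<open>radial\<close> keeps the whole segment inside the spectral region of analyticity,
  which nonnegativity of \<open>spectral_size\<close> alone would not give. In the last claim
  \<open>M\<close> has to bound the derivative only at those points of the ball where
  \<open>spectral_size (x - A) < R\<close>, a weaker demand than on the full ball.\<close>

theorem theorem4:
  fixes F :: "'a::spectral_state_space \<Rightarrow> 'b::spectral_state_space"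
    and A \<delta> :: 'a and n :: nat and R :: real
  assumes radial: "\<And>(x::'a) t. 0 \<le> t \<Longrightarrow> t \<le> 1 \<Longrightarrow> spectral_size (t *\<^sub>R x) \<le> spectral_size x"
    and analytic: "spectrally_analytic_at F A R"
    and size: "spectral_size \<delta> < R"
  shows "norm (F (A + \<delta>) - F A)
           \<le> (\<Sum>k=1..n. 1 / fact k * spectral_derivative_norm F k A * norm \<delta> ^ k)
              + norm (spectral_remainder F n A \<delta>)
       \<and> ereal (norm (spectral_remainder F n A \<delta>))
           \<le> remainder_constant F R (n + 1) A \<delta> * ereal (norm \<delta> ^ (n + 1))
       \<and> (\<forall>M. (\<forall>x\<in>cball A (norm \<delta>). spectral_size (x - A) < R \<longrightarrow>
                  spectral_derivative_norm F (n + 1) x \<le> M)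
            \<longrightarrow> remainder_constant F R (n + 1) A \<delta> \<le> ereal (M / fact (n + 1)))"
proof (intro conjI allI impI)
  let ?D = "\<lambda>k x. spectral_derivative F k x"
  let ?C = "remainder_constant F R (n + 1) A \<delta>"
  have admissible: "spectral_size (t *\<^sub>R \<delta>) < R" if "t \<in> {0..1}" for t
    using radial[of t \<delta>] size that by auto
  then have diff: "spectrally_differentiable F k (A + t *\<^sub>R \<delta>)" if "t \<in> {0..1}" for k t
    using analytic that unfolding spectrally_analytic_at_def by blast
  then have bml: "bounded_multilinear k (?D k (A + t *\<^sub>R \<delta>))" if "t \<in> {0..1}" for k t
    using that by (intro bounded_multilinear_spectral_derivative)
  have "norm ((1 / fact k) *\<^sub>R ?D k A (replicate k \<delta>))
      \<le> 1 / fact k * spectral_derivative_norm F k A * norm \<delta> ^ k" for k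
    using norm_replicate_le_multilinear_norm[OF bml[of 0 k], of \<delta>] by (simp add: divide_right_mono)
  then have "norm (\<Sum>k=1..n. (1 / fact k) *\<^sub>R ?D k A (replicate k \<delta>))
      \<le> (\<Sum>k=1..n. 1 / fact k * spectral_derivative_norm F k A * norm \<delta> ^ k)"
    by (intro sum_norm_le)
  moreover have "F (A + \<delta>) - F A =
      (\<Sum>k=1..n. (1 / fact k) *\<^sub>R ?D k A (replicate k \<delta>)) + spectral_remainder F n A \<delta>"
    by (simp add: spectral_remainder_def)
  ultimately show "norm (F (A + \<delta>) - F A)
      \<le> (\<Sum>k=1..n. 1 / fact k * spectral_derivative_norm F k A * norm \<delta> ^ k)
         + norm (spectral_remainder F n A \<delta>)"
    using norm_triangle_ineq[of "\<Sum>k=1..n. (1 / fact k) *\<^sub>R ?D k A (replicate k \<delta>)"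
        "spectral_remainder F n A \<delta>"]
    by simp
  \<comment> \<open>The Taylor bound with \<open>Suc n\<close> terms at \<open>s = 1\<close>. The
    constant \<open>K\<close> stays free because two values occur: one built from a finite
    \<open>?C\<close>, and 0 when \<open>\<delta> = 0\<close>.\<close>
  have remainder: "norm (spectral_remainder F n A \<delta>) \<le> K / fact (n + 1)"
    if K: "\<And>t. t \<in> {0..1} \<Longrightarrow> norm (?D (Suc n) (A + t *\<^sub>R \<delta>) (replicate (Suc n) \<delta>)) \<le> K" for K
  proof -
    have "norm (F (A + \<delta>) - (\<Sum>k<Suc n. (1 / fact k) *\<^sub>R ?D k A (replicate k \<delta>)))
        \<le> K / fact (n + 1)"
      using vector_taylor_bound[of "Suc n" "\<lambda>k t. ?D k (A + t *\<^sub>R \<delta>) (replicate k \<delta>)" K 1]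
        has_vector_derivative_spectral_derivative_segment[OF diff] K
      by (simp del: spectral_derivative.simps(2) replicate_Suc fact_Suc sum.lessThan_Suc)
    \<comment> \<open>The Taylor sum starts at order 0, whose term is \<open>F A\<close>;
      \<open>spectral_remainder\<close> subtracts that term separately.\<close>
    moreover have "{..<Suc n} = insert 0 {1..n}"
      by auto
    ultimately show ?thesis
      by (simp add: spectral_remainder_def diff_diff_eq del: spectral_derivative.simps(2) fact_Suc)
  qed
  have term_le: "ereal (1 / fact (n + 1) * spectral_derivative_norm F (n + 1) (A + t *\<^sub>R \<delta>)) \<le> ?C"
    if "t \<in> {0..1}" for t
    unfolding remainder_constant_def using admissible[OF that] that by (intro SUP_upper) auto
  \<comment> \<open>The index \<open>t = 0\<close> is admissible, so \<open>?C\<close> dominates a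
    nonnegative number; this excludes the value minus infinity below.\<close>
  have "0 \<le> spectral_derivative_norm F (n + 1) (A + 0 *\<^sub>R \<delta>)"
    by (intro multilinear_norm_nonneg bml) auto
  then have "0 \<le> ereal (1 / fact (n + 1) * spectral_derivative_norm F (n + 1) (A + 0 *\<^sub>R \<delta>))"
    by (simp del: spectral_derivative.simps fact_Suc)
  also have "\<dots> \<le> ?C"
    by (rule term_le) simp
  finally have C_nonneg: "0 \<le> ?C" .
  show "ereal (norm (spectral_remainder F n A \<delta>)) \<le> ?C * ereal (norm \<delta> ^ (n + 1))"
  proof (cases ?C)
    case (real c)
    \<comment> \<open>The factor \<open>fact (n + 1)\<close> undoes the normalisation inside
      \<open>?C\<close> and cancels in \<open>remainder\<close>.\<close>
    have "norm (?D (Suc n) (A + t *\<^sub>R \<delta>) (replicate (Suc n) \<delta>))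
        \<le> fact (n + 1) * c * norm \<delta> ^ (n + 1)" if "t \<in> {0..1}" for t
    proof -
      have "spectral_derivative_norm F (Suc n) (A + t *\<^sub>R \<delta>) \<le> fact (n + 1) * c"
        using term_le[OF that] real
        by (simp add: divide_simps mult.commute del: spectral_derivative.simps fact_Suc)
      then show ?thesis
        using norm_replicate_le_multilinear_norm[OF bml[OF that, of "Suc n"], of \<delta>]
        by (simp del: spectral_derivative.simps fact_Suc replicate_Suc power_Suc)
          (meson mult_right_mono norm_ge_zero order_trans zero_le_power)
    qed
    from remainder[OF this] show ?thesis
      using real by simp
  next
    case PInf
    show ?thesis
    \<comment> \<open>In \<open>ereal\<close>, infinity times 0 is 0, so for
      \<open>\<delta> = 0\<close> the remainder itself must be shown to vanish.\<close>
    proof (cases "\<delta> = 0")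
      case True
      have "norm (?D (Suc n) (A + t *\<^sub>R \<delta>) (replicate (Suc n) \<delta>)) \<le> 0" if "t \<in> {0..1}" for t
        using norm_replicate_le_multilinear_norm[OF bml[OF that, of "Suc n"], of \<delta>] True by simp
      from remainder[OF this] show ?thesis
        using True by (simp flip: zero_ereal_def)
    next
      case False
      then show ?thesis
        using PInf by simp
    qed
  next
    case MInf
    then show ?thesis
      using C_nonneg by simp
  qed
  show "?C \<le> ereal (M / fact (n + 1))"
    if M: "\<forall>x\<in>cball A (norm \<delta>). spectral_size (x - A) < R \<longrightarrow>
      spectral_derivative_norm F (n + 1) x \<le> M" for M
    unfolding remainder_constant_def
  proof (rule SUP_least)
    fix t assume t: "t \<in> {t \<in> {0..1}. spectral_size (t *\<^sub>R \<delta>) < R}"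
    then have "A + t *\<^sub>R \<delta> \<in> cball A (norm \<delta>)"
      by (auto simp: dist_norm mult_left_le_one_le)
    then have "spectral_derivative_norm F (n + 1) (A + t *\<^sub>R \<delta>) \<le> M"
      using M t by auto
    then show "ereal (1 / fact (n + 1) * spectral_derivative_norm F (n + 1) (A + t *\<^sub>R \<delta>))
        \<le> ereal (M / fact (n + 1))"
      by (simp add: divide_right_mono del: spectral_derivative.simps fact_Suc)
  qed
qed

end
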